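(* Let $\Omega=[0,1]$ and let $\mathcal{F}=\mathcal{B}[0,1]$ be its Borel sigma-algebra. Suppose that $H:B(\Omega,\mathcal{F})\to[-\infty,\infty)$ is $\lVert\cdot\rVert_\infty$-continuous when restricted to its domain, monotone, positively homogeneous, and strictly comonotonic subadditive. Then there exists a set $D(H)$ of maps from $B(\Omega,\mathcal{F})$ to $[-\infty,\infty)$ that are comonotonic additive and $\lVert\cdot\rVert_\infty$-continuous when restricted to their domains, such that $$H(x)=\sup_{Q\in D(H)}Q(x)\quad\text{for all } x\in B(\Omega,\mathcal{F}).$$ Moreover, $H$ is comonotonic subadditive on its domain.
   Context: $B(\Omega,\mathcal{F})$ is the space of bounded $\mathcal{F}$-measurable functions $\Omega\to\mathbb{R}$ with the sup norm $\lVert\cdot\rVert_\infty$ and the pointwise order. For $G:B(\Omega,\mathcal{F})\to[-\infty,\infty)$, its domain is $\mathrm{dom}\,G=\{x: G(x)>-\infty\}$. The usual arithmetic is used: $a+(-\infty)=-\infty$ for $a\in[-\infty,\infty)$, and $\lambda\cdot(-\infty)=-\infty$ for $\lambda>0$. $H$ is monotone if $x\leq y$ pointwise implies $H(x)\leq H(y)$; it is positively homogeneous if $H(\lambda x)=\lambda H(x)$ for all $\lambda>0$ and all $x$. Two functions $x,y$ are comonotonic if $[x(\omega_1)-x(\omega_2)][y(\omega_1)-y(\omega_2)]\geq 0$ for all $\omega_1,\omega_2\in\Omega$. Let $C_y=\{\lambda y:\lambda>0\}$. Two functions $x,y$ are strictly comonotonic if either $x\in C_y$, or $[x(\omega_1)-x(\omega_2)][y(\omega_1)-y(\omega_2)]>0$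 for all $\omega_1\neq\omega_2$ in $\Omega$. $H$ is strictly comonotonic subadditive if $H(x+y)\leq H(x)+H(y)$ for all strictly comonotonic $x,y\in B(\Omega,\mathcal{F})$. A map $G$ is comonotonic additive (respectively comonotonic subadditive) on its domain if $G(x+y)=G(x)+G(y)$ (respectively $G(x+y)\leq G(x)+G(y)$) for all comonotonic $x,y\in\mathrm{dom}\,G$. *)

theory Defs
  imports "HOL-Analysis.Analysis"
begin

text \<open>
  Functions on \<open>\<Omega> = space M\<close> are represented by elements of \<^const>\<open>extensional\<close> \<open>(space M)\<close>,
  so that equality of functions means equality on \<open>\<Omega>\<close>; the pointwise operations restrict
  their results accordingly.
\<close>

definition bounded_measurable :: "'a measure \<Rightarrow> ('a \<Rightarrow> real) set" where
  "bounded_measurable M =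
     {x \<in> borel_measurable M. x \<in> extensional (space M) \<and> bounded (x ` space M)}"

definition fun_add :: "'a measure \<Rightarrow> ('a \<Rightarrow> real) \<Rightarrow> ('a \<Rightarrow> real) \<Rightarrow> 'a \<Rightarrow> real" where
  "fun_add M x y = (\<lambda>\<omega>\<in>space M. x \<omega> + y \<omega>)"

definition fun_scale :: "'a measure \<Rightarrow> real \<Rightarrow> ('a \<Rightarrow> real) \<Rightarrow> 'a \<Rightarrow> real" where
  "fun_scale M c x = (\<lambda>\<omega>\<in>space M. c * x \<omega>)"

text \<open>
  The library metric \<open>funspace (space M) euclidean_metric\<close> on bounded extensional functions is the
  one induced by the supremum norm.
\<close>

abbreviation sup_metric :: "'a measure \<Rightarrow> ('a \<Rightarrow> real) metric" where
  "sup_metric M \<equiv> funspace (space M) euclidean_metric"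

lemma bounded_measurable_subset_mspace:
  "bounded_measurable M \<subseteq> mspace (sup_metric M)"
  by (auto simp: bounded_measurable_def Met_TC.fspace_def mbounded_iff_bounded)

lemma mdist_sup_metric:
  assumes "x \<in> bounded_measurable M" "y \<in> bounded_measurable M" "space M \<noteq> {}"
  shows "mdist (sup_metric M) x y = (SUP \<omega>\<in>space M. \<bar>x \<omega> - y \<omega>\<bar>)"
proof -
  have "x \<in> Met_TC.fspace (space M)" "y \<in> Met_TC.fspace (space M)"
    using assms(1,2) bounded_measurable_subset_mspace[of M] by auto
  then show ?thesis
    using assms(3) by (simp add: Met_TC.fdist_def dist_real_def)
qed

definition effective_domain :: "'a measure \<Rightarrow> (('a \<Rightarrow> real) \<Rightarrow> ereal) \<Rightarrow> ('a \<Rightarrow> real) set" where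
  "effective_domain M G = {x \<in> bounded_measurable M. G x > - \<infinity>}"

text \<open>
  Functionals take values in \<open>[-\<infinity>, \<infinity>)\<close>, so on the effective domain they are finite, where the
  topology of \<^typ>\<open>ereal\<close> induces the usual one of the reals.
\<close>

definition extended_functional :: "'a measure \<Rightarrow> (('a \<Rightarrow> real) \<Rightarrow> ereal) \<Rightarrow> bool" where
  "extended_functional M G \<longleftrightarrow> (\<forall>x\<in>bounded_measurable M. G x < \<infinity>)"

definition continuous_on_domain :: "'a measure \<Rightarrow> (('a \<Rightarrow> real) \<Rightarrow> ereal) \<Rightarrow> bool" where
  "continuous_on_domain M G \<longleftrightarrow>
     continuous_map (subtopology (mtopology_of (sup_metric M)) (effective_domain M G)) euclidean G"

definition monotone_functional :: "'a measure \<Rightarrow> (('a \<Rightarrow> real) \<Rightarrow> ereal) \<Rightarrow> bool" where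
  "monotone_functional M H \<longleftrightarrow>
     (\<forall>x\<in>bounded_measurable M. \<forall>y\<in>bounded_measurable M.
        (\<forall>\<omega>\<in>space M. x \<omega> \<le> y \<omega>) \<longrightarrow> H x \<le> H y)"

definition positively_homogeneous :: "'a measure \<Rightarrow> (('a \<Rightarrow> real) \<Rightarrow> ereal) \<Rightarrow> bool" where
  "positively_homogeneous M H \<longleftrightarrow>
     (\<forall>c>0. \<forall>x\<in>bounded_measurable M. H (fun_scale M c x) = ereal c * H x)"

definition comonotonic :: "'a measure \<Rightarrow> ('a \<Rightarrow> real) \<Rightarrow> ('a \<Rightarrow> real) \<Rightarrow> bool" where
  "comonotonic M x y \<longleftrightarrow>
     (\<forall>\<omega>1\<in>space M. \<forall>\<omega>2\<in>space M. (x \<omega>1 - x \<omega>2) * (y \<omega>1 - y \<omega>2) \<ge> 0)"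

definition open_ray :: "'a measure \<Rightarrow> ('a \<Rightarrow> real) \<Rightarrow> ('a \<Rightarrow> real) set" where
  "open_ray M y = {fun_scale M c y |c. c > 0}"

definition strictly_comonotonic :: "'a measure \<Rightarrow> ('a \<Rightarrow> real) \<Rightarrow> ('a \<Rightarrow> real) \<Rightarrow> bool" where
  "strictly_comonotonic M x y \<longleftrightarrow>
     x \<in> open_ray M y \<or>
     (\<forall>\<omega>1\<in>space M. \<forall>\<omega>2\<in>space M. \<omega>1 \<noteq> \<omega>2 \<longrightarrow> (x \<omega>1 - x \<omega>2) * (y \<omega>1 - y \<omega>2) > 0)"

definition strictly_comonotonic_subadditive :: "'a measure \<Rightarrow> (('a \<Rightarrow> real) \<Rightarrow> ereal) \<Rightarrow> bool" where
  "strictly_comonotonic_subadditive M H \<longleftrightarrow>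
     (\<forall>x\<in>bounded_measurable M. \<forall>y\<in>bounded_measurable M.
        strictly_comonotonic M x y \<longrightarrow> H (fun_add M x y) \<le> H x + H y)"

definition comonotonic_additive_on_domain :: "'a measure \<Rightarrow> (('a \<Rightarrow> real) \<Rightarrow> ereal) \<Rightarrow> bool" where
  "comonotonic_additive_on_domain M G \<longleftrightarrow>
     (\<forall>x\<in>effective_domain M G. \<forall>y\<in>effective_domain M G.
        comonotonic M x y \<longrightarrow> G (fun_add M x y) = G x + G y)"

definition comonotonic_subadditive_on_domain :: "'a measure \<Rightarrow> (('a \<Rightarrow> real) \<Rightarrow> ereal) \<Rightarrow> bool" where
  "comonotonic_subadditive_on_domain M G \<longleftrightarrow>
     (\<forall>x\<in>effective_domain M G. \<forall>y\<in>effective_domain M G.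
        comonotonic M x y \<longrightarrow> G (fun_add M x y) \<le> G x + G y)"

end

theory Submission
  imports Defs
begin

text \<open>
  For the supremum representation, restrict \<open>H\<close> to the rays \<open>C\<^sub>y\<close>: by positive homogeneity the
  functional that equals \<open>H\<close> on \<open>C\<^sub>y\<close> and \<open>-\<infinity>\<close> elsewhere is additive on its domain.

  For comonotonic subadditivity, comonotonic \<open>x\<close>, \<open>y\<close> are approximated uniformly from above by
  strictly comonotonic pairs. Ties cannot be broken for \<open>x\<close> and \<open>y\<close> themselves, since a lexicographic
  order need not embed into the reals; but rounding \<open>x\<close> and \<open>y\<close> to a grid preserves comonotonicity
  and leaves integer levels, whose ties are broken by an injective function with values in \<open>[0,1]\<close>.
  Approximating from above keeps the pairs in the domain of \<open>H\<close> by monotonicity.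
\<close>

section \<open>Closure properties of bounded measurable functions\<close>

lemma bounded_measurableI:
  assumes "f \<in> borel_measurable M" "\<And>\<omega>. \<omega> \<in> space M \<Longrightarrow> \<bar>f \<omega>\<bar> \<le> b"
  shows "restrict f (space M) \<in> bounded_measurable M"
proof -
  have "restrict f (space M) \<in> borel_measurable M"
    using assms(1) by (simp cong: measurable_cong)
  then show ?thesis
    using assms(2) by (auto simp: bounded_measurable_def bounded_real intro!: exI[of _ b])
qed

lemma bounded_measurableE:
  assumes "x \<in> bounded_measurable M"
  obtains b where "\<And>\<omega>. \<omega> \<in> space M \<Longrightarrow> \<bar>x \<omega>\<bar> \<le> b"
  using assms by (auto simp: bounded_measurable_def bounded_real)

lemma fun_add_bounded_measurable:
  assumes "x \<in> bounded_measurable M" "y \<in> bounded_measurable M"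
  shows "fun_add M x y \<in> bounded_measurable M"
proof -
  obtain b c where "\<And>\<omega>. \<omega> \<in> space M \<Longrightarrow> \<bar>x \<omega>\<bar> \<le> b" "\<And>\<omega>. \<omega> \<in> space M \<Longrightarrow> \<bar>y \<omega>\<bar> \<le> c"
    using assms by (metis bounded_measurableE)
  then have "\<bar>x \<omega> + y \<omega>\<bar> \<le> b + c" if "\<omega> \<in> space M" for \<omega>
    using that by fastforce
  moreover have "(\<lambda>\<omega>. x \<omega> + y \<omega>) \<in> borel_measurable M"
    using assms by (auto simp: bounded_measurable_def)
  ultimately show ?thesis
    unfolding fun_add_def by (intro bounded_measurableI)
qed

lemma mem_open_ray_self:
  assumes "x \<in> bounded_measurable M"
  shows "x \<in> open_ray M x"
proof -
  have "fun_scale M 1 x = x"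
    using assms by (simp add: fun_scale_def bounded_measurable_def extensional_restrict)
  then show ?thesis
    unfolding open_ray_def by (metis (mono_tags, lifting) mem_Collect_eq zero_less_one)
qed

section \<open>Supremum of functionals concentrated on rays\<close>

text \<open>The value -\<infinity> off the ray removes those points from the effective domain and is
  neutral in a supremum.\<close>

definition ray_restriction ::
    "'a measure \<Rightarrow> (('a \<Rightarrow> real) \<Rightarrow> ereal) \<Rightarrow> ('a \<Rightarrow> real) \<Rightarrow> ('a \<Rightarrow> real) \<Rightarrow> ereal" where
  "ray_restriction M H y x = (if x \<in> open_ray M y then H x else - \<infinity>)"

lemma ray_restriction_extended_functional:
  "extended_functional M H \<Longrightarrow> extended_functional M (ray_restriction M H y)"
  by (simp add: extended_functional_def ray_restriction_def)

text \<open>All elements of the effective domain are positive multiples of the one function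
  \<open>y\<close>, so additivity reduces to distributivity over the coefficients of
  \<open>H y\<close>.\<close>

lemma ray_restriction_comonotonic_additive:
  assumes "positively_homogeneous M H" "y \<in> bounded_measurable M"
  shows "comonotonic_additive_on_domain M (ray_restriction M H y)"
  unfolding comonotonic_additive_on_domain_def
proof (intro ballI impI)
  fix u v
  assume "u \<in> effective_domain M (ray_restriction M H y)"
    and "v \<in> effective_domain M (ray_restriction M H y)"
  then obtain c d where c: "c > 0" "u = fun_scale M c y" and d: "d > 0" "v = fun_scale M d y"
    by (auto simp: effective_domain_def ray_restriction_def open_ray_def split: if_splits)
  have uv: "fun_add M u v = fun_scale M (c + d) y"
    by (auto simp: c d fun_add_def fun_scale_def distrib_right)
  have ray: "fun_scale M t y \<in> open_ray M y" if "t > 0" for t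
    using that by (auto simp: open_ray_def)
  have H: "H (fun_scale M t y) = ereal t * H y" if "t > 0" for t
    using assms that by (simp add: positively_homogeneous_def)
  \<comment> \<open>In \<open>ereal\<close> this holds for nonnegative coefficients, whatever the
    value of \<open>H y\<close>.\<close>
  have "ereal (c + d) * H y = ereal c * H y + ereal d * H y"
    using c d by (simp add: ereal_left_distrib flip: plus_ereal.simps(1))
  moreover have "ray_restriction M H y (fun_scale M t y) = ereal t * H y" if "t > 0" for t
    using that by (simp add: ray_restriction_def ray H)
  ultimately show "ray_restriction M H y (fun_add M u v) = ray_restriction M H y u + ray_restriction M H y v"
    using c(1) d(1) unfolding uv unfolding c(2) d(2) by simp
qed

lemma ray_restriction_continuous:
  assumes "continuous_on_domain M H"
  shows "continuous_on_domain M (ray_restriction M H y)"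
proof -
  have "effective_domain M (ray_restriction M H y) \<subseteq> effective_domain M H"
    by (auto simp: effective_domain_def ray_restriction_def split: if_splits)
  then have "continuous_map (subtopology (mtopology_of (sup_metric M))
      (effective_domain M (ray_restriction M H y))) euclidean H"
    using assms unfolding continuous_on_domain_def by (rule continuous_map_from_subtopology_mono[rotated])
  then show ?thesis
    unfolding continuous_on_domain_def
    by (rule continuous_map_eq) (auto simp: effective_domain_def ray_restriction_def split: if_splits)
qed

text \<open>Each term is \<open>H x\<close> or -\<infinity>, and the index \<open>y = x\<close>
  attains \<open>H x\<close>.\<close>

lemma SUP_ray_restriction:
  assumes "x \<in> bounded_measurable M"
  shows "(SUP y\<in>bounded_measurable M. ray_restriction M H y x) = H x"
proof (rule antisym)
  show "(SUP y\<in>bounded_measurable M. ray_restriction M H y x) \<le> H x"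
    by (rule SUP_least) (simp add: ray_restriction_def)
  show "H x \<le> (SUP y\<in>bounded_measurable M. ray_restriction M H y x)"
    by (rule SUP_upper2[OF assms]) (simp add: ray_restriction_def mem_open_ray_self[OF assms])
qed

section \<open>Strictly comonotonic approximation from above\<close>

text \<open>Both approximants are strictly increasing functions of a single injective key
  \<open>z\<close>, hence strictly comonotonic.\<close>

lemma strictly_comonotonic_approx_above:
  fixes \<tau> :: "'a \<Rightarrow> real"
  assumes x: "x \<in> bounded_measurable M" and y: "y \<in> bounded_measurable M"
    and xy: "comonotonic M x y"
    and \<tau>: "\<tau> \<in> borel_measurable M" "inj_on \<tau> (space M)" "\<tau> ` space M \<subseteq> {0..1}"
    and "\<epsilon> > 0"
  obtains x' y' where "x' \<in> bounded_measurable M" "y' \<in> bounded_measurable M"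
    "strictly_comonotonic M x' y'"
    "\<And>\<omega>. \<omega> \<in> space M \<Longrightarrow> x \<omega> \<le> x' \<omega> \<and> x' \<omega> \<le> x \<omega> + \<epsilon>"
    "\<And>\<omega>. \<omega> \<in> space M \<Longrightarrow> y \<omega> \<le> y' \<omega> \<and> y' \<omega> \<le> y \<omega> + \<epsilon>"
proof -
  \<comment> \<open>One half of \<epsilon> pays for rounding to the grid of mesh \<open>h\<close>,
    the other for breaking ties.\<close>
  define h where "h = \<epsilon> / 2"
  have h: "h > 0" "\<epsilon> = h + h"
    using \<open>\<epsilon> > 0\<close> by (auto simp: h_def)
  define a b where "a \<omega> = \<lfloor>x \<omega> / h\<rfloor>" and "b \<omega> = \<lfloor>y \<omega> / h\<rfloor>" for \<omega>
  \<comment> \<open>The sum of the levels orders both levels at once. Since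
    \<open>\<tau> / 2\<close> stays in [0, 1/2], below the gap between integers, it decides only
    among equal sums.\<close>
  define z where "z \<omega> = real_of_int (a \<omega> + b \<omega>) + \<tau> \<omega> / 2" for \<omega>
  obtain B where B: "\<And>\<omega>. \<omega> \<in> space M \<Longrightarrow> \<bar>x \<omega>\<bar> \<le> B"
    using bounded_measurableE[OF x] by metis
  obtain C where C: "\<And>\<omega>. \<omega> \<in> space M \<Longrightarrow> \<bar>y \<omega>\<bar> \<le> C"
    using bounded_measurableE[OF y] by metis
  \<comment> \<open>\<open>K\<close> bounds the absolute value of \<open>z\<close>: each floor loses
    at most 1 and \<open>\<tau> / 2\<close> adds at most 1/2. The absolute values of
    \<open>B\<close> and \<open>C\<close> ensure \<open>K > 0\<close>.\<close>
  define B' C' K where "B' = \<bar>B\<bar> / h" and "C' = \<bar>C\<bar> / h" and "K = B' + C' + 3"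
  have K: "K > 0"
    using h by (simp add: K_def B'_def C'_def add_nonneg_pos)
  \<comment> \<open>The added 1 turns the floor into rounding upwards, with an excess of at most
    \<open>h\<close>.\<close>
  have grid: "r \<le> h * (of_int \<lfloor>r / h\<rfloor> + 1) \<and> h * (of_int \<lfloor>r / h\<rfloor> + 1) \<le> r + h" for r :: real
  proof -
    have "r / h \<le> of_int \<lfloor>r / h\<rfloor> + 1" "of_int \<lfloor>r / h\<rfloor> + 1 \<le> r / h + 1"
      by linarith+
    then show ?thesis
      using h(1) by (simp add: field_simps)
  qed
  have z_bound: "0 \<le> z \<omega> + K \<and> z \<omega> + K \<le> 2 * K" if "\<omega> \<in> space M" for \<omega>
  proof -
    have "\<bar>x \<omega> / h\<bar> \<le> B'" "\<bar>y \<omega> / h\<bar> \<le> C'"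
      using B[OF that] C[OF that] h(1) by (auto simp: B'_def C'_def abs_divide divide_right_mono)
    then have "- B' - 1 \<le> real_of_int (a \<omega>)" "real_of_int (a \<omega>) \<le> B'"
      "- C' - 1 \<le> real_of_int (b \<omega>)" "real_of_int (b \<omega>) \<le> C'"
      unfolding a_def b_def by linarith+
    moreover have "0 \<le> \<tau> \<omega>" "\<tau> \<omega> \<le> 1"
      using \<tau>(3) that by auto
    ultimately have "0 \<le> z \<omega> + K" "z \<omega> + K \<le> 2 * K"
      by (simp_all add: z_def K_def)
    then show ?thesis ..
  qed
  \<comment> \<open>Scales the shifted key from [0, 2K] to [0, h], so the perturbation is
    nonnegative and uses the second half of \<epsilon>.\<close>
  define \<delta> where "\<delta> = h / (2 * K)"
  have \<delta>: "\<delta> > 0" "\<delta> * (2 * K) = h"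
    using h K by (auto simp: \<delta>_def)
  have z_small: "0 \<le> \<delta> * (z \<omega> + K) \<and> \<delta> * (z \<omega> + K) \<le> h" if "\<omega> \<in> space M" for \<omega>
    using z_bound[OF that] \<delta> by (metis mult_left_mono mult_nonneg_nonneg less_imp_le)
  define x' y' where "x' = (\<lambda>\<omega>\<in>space M. h * (a \<omega> + 1) + \<delta> * (z \<omega> + K))"
    and "y' = (\<lambda>\<omega>\<in>space M. h * (b \<omega> + 1) + \<delta> * (z \<omega> + K))"
  have x'_approx: "x \<omega> \<le> x' \<omega> \<and> x' \<omega> \<le> x \<omega> + \<epsilon>" if "\<omega> \<in> space M" for \<omega>
    using grid[of "x \<omega>"] z_small[OF that] that by (simp add: x'_def a_def h(2))
  have y'_approx: "y \<omega> \<le> y' \<omega> \<and> y' \<omega> \<le> y \<omega> + \<epsilon>" if "\<omega> \<in> space M" for \<omega>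
    using grid[of "y \<omega>"] z_small[OF that] that by (simp add: y'_def b_def h(2))
  have [measurable]: "x \<in> borel_measurable M" "y \<in> borel_measurable M" "\<tau> \<in> borel_measurable M"
    using x y \<tau> by (auto simp: bounded_measurable_def)
  have x'_mem: "x' \<in> bounded_measurable M"
    unfolding x'_def
  proof (rule bounded_measurableI)
    show "(\<lambda>\<omega>. h * (a \<omega> + 1) + \<delta> * (z \<omega> + K)) \<in> borel_measurable M"
      unfolding z_def a_def b_def by measurable
    show "\<bar>h * (a \<omega> + 1) + \<delta> * (z \<omega> + K)\<bar> \<le> B + \<epsilon>" if "\<omega> \<in> space M" for \<omega>
      using x'_approx[OF that] B[OF that] \<open>\<epsilon> > 0\<close> that unfolding x'_def by auto
  qed
  have y'_mem: "y' \<in> bounded_measurable M"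
    unfolding y'_def
  proof (rule bounded_measurableI)
    show "(\<lambda>\<omega>. h * (b \<omega> + 1) + \<delta> * (z \<omega> + K)) \<in> borel_measurable M"
      unfolding z_def a_def b_def by measurable
    show "\<bar>h * (b \<omega> + 1) + \<delta> * (z \<omega> + K)\<bar> \<le> C + \<epsilon>" if "\<omega> \<in> space M" for \<omega>
      using y'_approx[OF that] C[OF that] \<open>\<epsilon> > 0\<close> that unfolding y'_def by auto
  qed
  \<comment> \<open>A strict rise in level forces a strict rise of the function. By comonotonicity
    the two levels cannot move in opposite directions, so comparing their sums compares each of
    them.\<close>
  have same_order: "a s \<le> a t \<and> b s \<le> b t"
    if "s \<in> space M" "t \<in> space M" "a s + b s \<le> a t + b t" for s t
  proof -
    have "x s < x t" if "a s < a t" for s t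
      using that h(1) unfolding a_def by (metis divide_right_mono floor_mono leD leI less_imp_le)
    moreover have "y s < y t" if "b s < b t" for s t
      using that h(1) unfolding b_def by (metis divide_right_mono floor_mono leD leI less_imp_le)
    moreover have "\<not> (x s < x t \<and> y t < y s)" "\<not> (x t < x s \<and> y s < y t)"
      using xy that(1,2) unfolding comonotonic_def
      by (metis diff_gt_0_iff_gt diff_less_0_iff_less leD mult_neg_pos mult_pos_neg)+
    ultimately show ?thesis
      using that(3) by (smt (verit))
  qed
  have incr: "x' s < x' t \<and> y' s < y' t" if "s \<in> space M" "t \<in> space M" "z s < z t" for s t
  proof -
    have "0 \<le> \<tau> s" "\<tau> t \<le> 1"
      using \<tau>(3) that by auto
    \<comment> \<open>The left sum is less than the right sum plus 1/2, and both are
      integers.\<close>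
    then have "a s + b s \<le> a t + b t"
      using that(3) unfolding z_def by linarith
    then have "h * (a s + 1) \<le> h * (a t + 1)" "h * (b s + 1) \<le> h * (b t + 1)"
      using same_order[OF that(1,2)] h(1) by auto
    moreover have "\<delta> * (z s + K) < \<delta> * (z t + K)"
      using that \<delta>(1) by simp
    ultimately show ?thesis
      using that(1,2) by (simp add: x'_def y'_def)
  qed
  have z_inj: "z s \<noteq> z t" if "s \<in> space M" "t \<in> space M" "s \<noteq> t" for s t
  proof
    assume eq: "z s = z t"
    have "0 \<le> \<tau> s" "\<tau> s \<le> 1" "0 \<le> \<tau> t" "\<tau> t \<le> 1"
      using \<tau>(3) that by auto
    \<comment> \<open>The two integers differ by at most 1/2.\<close>
    with eq have "a s + b s = a t + b t"
      unfolding z_def by linarith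
    with eq have "\<tau> s = \<tau> t"
      by (simp add: z_def)
    with \<tau>(2) that show False
      by (auto dest: inj_onD)
  qed
  have "(x' s - x' t) * (y' s - y' t) > 0" if "s \<in> space M" "t \<in> space M" "s \<noteq> t" for s t
    using z_inj[OF that] incr[OF that(1,2)] incr[OF that(2,1)]
    by (cases "z s < z t") (auto intro: mult_pos_pos mult_neg_neg)
  then have "strictly_comonotonic M x' y'"
    unfolding strictly_comonotonic_def by blast
  with x'_mem y'_mem x'_approx y'_approx show thesis
    by (intro that)
qed

section \<open>Passage to the limit in the subadditivity inequality\<close>

lemma continuous_on_domain_sequentially:
  assumes H: "continuous_on_domain M H" and x: "x \<in> effective_domain M H"
    and X: "\<And>n. X n \<in> effective_domain M H"
    and le: "\<And>n \<omega>. \<omega> \<in> space M \<Longrightarrow> \<bar>X n \<omega> - x \<omega>\<bar> \<le> \<epsilon> n" and \<epsilon>: "\<epsilon> \<longlonglongrightarrow> 0"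
    and "space M \<noteq> {}"
  shows "(\<lambda>n. H (X n)) \<longlonglongrightarrow> H x"
proof -
  have mem: "x \<in> bounded_measurable M" "X n \<in> bounded_measurable M" for n
    using x X by (auto simp: effective_domain_def)
  have dist: "mdist (sup_metric M) (X n) x \<le> \<epsilon> n" for n
    unfolding mdist_sup_metric[OF mem(2,1) \<open>space M \<noteq> {}\<close>]
    using \<open>space M \<noteq> {}\<close> le by (intro cSUP_least)
  have "\<forall>\<^sub>F n in sequentially. mdist (sup_metric M) (X n) x < r" if "r > 0" for r
    using order_tendstoD(2)[OF \<epsilon> that] by eventually_elim (use dist in \<open>meson le_less_trans\<close>)
  moreover have "x \<in> mspace (sup_metric M)" "X n \<in> mspace (sup_metric M)" for n
    using mem bounded_measurable_subset_mspace by blast+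
  ultimately have "limitin (mtopology_of (sup_metric M)) X x sequentially"
    unfolding mtopology_of_def Metric_space.limitin_metric[OF Metric_space_mspace_mdist] by simp
  then have "limitin (subtopology (mtopology_of (sup_metric M)) (effective_domain M H)) X x sequentially"
    using x X by (simp add: limitin_subtopology)
  then have "limitin euclidean (H \<circ> X) (H x) sequentially"
    by (rule continuous_map_limit[OF H[unfolded continuous_on_domain_def]])
  then show ?thesis
    by (simp add: o_def)
qed

text \<open>Continuity is applied at \<open>x\<close> and \<open>y\<close> alone. At their sum,
  where \<open>H\<close> may be -\<infinity>, monotonicity bounds \<open>H\<close> by its values at
  the sums of the approximants.\<close>

lemma comonotonic_subadditive_if_strictly:
  fixes \<tau> :: "'a \<Rightarrow> real"
  assumes ext: "extended_functional M H" and cont: "continuous_on_domain M H"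
    and mono: "monotone_functional M H" and sub: "strictly_comonotonic_subadditive M H"
    and \<tau>: "\<tau> \<in> borel_measurable M" "inj_on \<tau> (space M)" "\<tau> ` space M \<subseteq> {0..1}"
    and ne: "space M \<noteq> {}"
  shows "comonotonic_subadditive_on_domain M H"
  unfolding comonotonic_subadditive_on_domain_def
proof (intro ballI impI)
  fix x y
  assume x: "x \<in> effective_domain M H" and y: "y \<in> effective_domain M H"
    and xy: "comonotonic M x y"
  have mem: "x \<in> bounded_measurable M" "y \<in> bounded_measurable M"
    using x y by (auto simp: effective_domain_def)
  define \<epsilon> where "\<epsilon> n = 1 / real (Suc n)" for n
  have "\<exists>x' y'. x' \<in> bounded_measurable M \<and> y' \<in> bounded_measurable M \<and> strictly_comonotonic M x' y' \<and>
      (\<forall>\<omega>\<in>space M. x \<omega> \<le> x' \<omega> \<and> x' \<omega> \<le> x \<omega> + \<epsilon> n) \<and>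
      (\<forall>\<omega>\<in>space M. y \<omega> \<le> y' \<omega> \<and> y' \<omega> \<le> y \<omega> + \<epsilon> n)" for n
  proof -
    have "\<epsilon> n > 0"
      by (simp add: \<epsilon>_def)
    from strictly_comonotonic_approx_above[OF mem xy \<tau> this] show ?thesis
      by metis
  qed
  then obtain X Y where XY: "\<And>n. X n \<in> bounded_measurable M" "\<And>n. Y n \<in> bounded_measurable M"
      "\<And>n. strictly_comonotonic M (X n) (Y n)"
      "\<And>n \<omega>. \<omega> \<in> space M \<Longrightarrow> x \<omega> \<le> X n \<omega> \<and> X n \<omega> \<le> x \<omega> + \<epsilon> n"
      "\<And>n \<omega>. \<omega> \<in> space M \<Longrightarrow> y \<omega> \<le> Y n \<omega> \<and> Y n \<omega> \<le> y \<omega> + \<epsilon> n"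
    by metis
  have ge: "H x \<le> H (X n)" "H y \<le> H (Y n)" for n
    using mono mem XY unfolding monotone_functional_def by blast+
  have dom: "X n \<in> effective_domain M H" "Y n \<in> effective_domain M H" for n
    using x y ge[of n] XY(1,2) by (auto simp: effective_domain_def intro: less_le_trans)
  have \<epsilon>: "\<epsilon> \<longlonglongrightarrow> 0"
    unfolding \<epsilon>_def by (rule LIMSEQ_Suc[OF lim_1_over_n])
  have close: "\<bar>X n \<omega> - x \<omega>\<bar> \<le> \<epsilon> n" "\<bar>Y n \<omega> - y \<omega>\<bar> \<le> \<epsilon> n" if "\<omega> \<in> space M" for n \<omega>
    using XY(4,5)[OF that, of n] by linarith+
  have "(\<lambda>n. H (X n)) \<longlonglongrightarrow> H x"
    by (rule continuous_on_domain_sequentially[OF cont x dom(1) close(1) \<epsilon> ne])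
  moreover have "(\<lambda>n. H (Y n)) \<longlonglongrightarrow> H y"
    by (rule continuous_on_domain_sequentially[OF cont y dom(2) close(2) \<epsilon> ne])
  \<comment> \<open>Addition in \<open>ereal\<close> is continuous at pairs of finite
    values.\<close>
  moreover have "\<bar>H x\<bar> \<noteq> \<infinity>" "\<bar>H y\<bar> \<noteq> \<infinity>"
    using x y ext by (auto simp: effective_domain_def extended_functional_def)
  ultimately have "(\<lambda>n. H (X n) + H (Y n)) \<longlonglongrightarrow> H x + H y"
    by (intro tendsto_add_ereal)
  moreover have "H (fun_add M x y) \<le> H (X n) + H (Y n)" for n
  proof -
    have "H (fun_add M x y) \<le> H (fun_add M (X n) (Y n))"
    proof -
      have "\<forall>\<omega>\<in>space M. fun_add M x y \<omega> \<le> fun_add M (X n) (Y n) \<omega>"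
        using XY(4,5) by (simp add: fun_add_def add_mono)
      then show ?thesis
        using mono mem XY(1,2) fun_add_bounded_measurable unfolding monotone_functional_def by blast
    qed
    also have "\<dots> \<le> H (X n) + H (Y n)"
      using sub XY(1,2,3) by (simp add: strictly_comonotonic_subadditive_def)
    finally show ?thesis .
  qed
  ultimately show "H (fun_add M x y) \<le> H x + H y"
    by (intro LIMSEQ_le_const) auto
qed

theorem proposition1:
  fixes H :: "(real \<Rightarrow> real) \<Rightarrow> ereal" and M :: "real measure"
  defines "M \<equiv> restrict_space borel {0..1}"
  assumes "extended_functional M H"
    and "continuous_on_domain M H"
    and "monotone_functional M H"
    and "positively_homogeneous M H"
    and "strictly_comonotonic_subadditive M H"
  shows "(\<exists>D :: ((real \<Rightarrow> real) \<Rightarrow> ereal) set.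
            (\<forall>Q\<in>D. extended_functional M Q \<and> comonotonic_additive_on_domain M Q \<and>
                   continuous_on_domain M Q) \<and>
            (\<forall>x\<in>bounded_measurable M. H x = (SUP Q\<in>D. Q x))) \<and>
         comonotonic_subadditive_on_domain M H"
proof (intro conjI exI ballI)
  show "comonotonic_subadditive_on_domain M H"
  proof (rule comonotonic_subadditive_if_strictly[OF assms(2,3,4,6)])
    \<comment> \<open>On the unit interval the identity serves as the injective tie-breaker
      \<tau>.\<close>
    show "(\<lambda>\<omega>. \<omega>) \<in> borel_measurable M"
      unfolding M_def by (intro measurable_restrict_space1) simp
  qed (auto simp: M_def space_restrict_space)
next
  fix x
  assume "x \<in> bounded_measurable M"
  \<comment> \<open>This fixes the witness for \<open>D\<close>: one ray restriction for each
    bounded measurable function.\<close>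
  then show "H x = (SUP Q\<in>ray_restriction M H ` bounded_measurable M. Q x)"
    by (simp add: SUP_ray_restriction image_image)
qed (use assms in \<open>auto intro: ray_restriction_extended_functional
    ray_restriction_comonotonic_additive ray_restriction_continuous\<close>)

end
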